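(* Let $N\ge 1$ be an integer and let $\mathcal{K}$ be a simplicial complex in $\mathbb{R}^N$. Then $\mathcal{K}$ is locally finite if and only if its underlying space $|\mathcal{K}|$ is locally compact.
   Context: Points $\mathbf{a}_0,\ldots,\mathbf{a}_n$ of $\mathbb{R}^N$ are geometrically independent if for all real scalars $t_i$, the equations $\sum_i t_i=0$ and $\sum_i t_i\mathbf{a}_i=\mathbf{0}$ imply $t_i=0$ for all $i$. The simplex spanned by such points (its vertices) is $\{\sum_{i=0}^n t_i\mathbf{a}_i : t_i\ge 0,\ \sum_i t_i=1\}$, with the subspace topology from $\mathbb{R}^N$. A face of a simplex is a simplex spanned by a non-empty subset of its vertices (possibly all of them). A simplicial complex in $\mathbb{R}^N$ is a non-empty, possibly infinite, collection $\mathcal{K}$ of simplices in $\mathbb{R}^N$ such that every face of a simplex of $\mathcal{K}$ is in $\mathcal{K}$, and for all $\sigma,\tau\in\mathcal{K}$ the intersection $\sigma\cap\tau$ is either empty or a face of both. The vertices of $\mathcal{K}$ are the points $\mathbf{a}$ with $\{\mathbf{a}\}\in\mathcal{K}$. The underlying space is $|\mathcal{K}|=\bigcup_{\sigma\in\mathcal{K}}\sigma$, with the topology in which $U\subset|\mathcal{K}|$ is open if and only if $U\cap\sigma$ is open in $\sigma$ for every $\sigma\in\mathcal{K}$. $\mathcal{K}$ is locally finite if for every vertex $\mathbf{a}$ of $\mathcal{K}$ the set $\{\sigma\in\mathcal{K}:\mathbf{a}\in\sigma\}$ is finite. A topological space $X$ is locally compact if every $x\in X$ has an open neighborhood $U$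 whose closure $\overline{U}$ is compact. *)

theory Defs
  imports "HOL-Analysis.Analysis"
begin

text \<open>
  The library predicate \<open>n simplex S\<close> says that \<open>S\<close> is the convex hull of \<open>n + 1\<close> affinely
  independent points. It admits \<open>n = -1\<close> (the empty simplex), which is excluded below by
  letting \<open>n\<close> range over the natural numbers. The following lemma spells it out in terms of
  coefficients.
\<close>

lemma simplex_iff_coefficients:
  fixes S :: "'a::euclidean_space set"
  shows "(\<exists>n::nat. int n simplex S) \<longleftrightarrow>
    (\<exists>C. finite C \<and> C \<noteq> {} \<and>
         (\<forall>t. sum t C = 0 \<and> (\<Sum>a\<in>C. t a *\<^sub>R a) = 0 \<longrightarrow> (\<forall>a\<in>C. t a = 0)) \<and>
         S = {y. \<exists>t. (\<forall>a\<in>C. 0 \<le> t a) \<and> sum t C = 1 \<and> (\<Sum>a\<in>C. t a *\<^sub>R a) = y})"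
    (is "?L \<longleftrightarrow> (\<exists>C. ?R C)")
proof
  assume ?L
  then obtain n C where C: "finite C" "\<not> affine_dependent C" "int (card C) = int n + 1"
      "S = convex hull C"
    unfolding simplex by blast
  then have "C \<noteq> {}" by auto
  moreover have "\<forall>t. sum t C = 0 \<and> (\<Sum>a\<in>C. t a *\<^sub>R a) = 0 \<longrightarrow> (\<forall>a\<in>C. t a = 0)"
    using C(2) unfolding affine_dependent_explicit_finite[OF C(1)] by blast
  ultimately have "?R C"
    using C(1) unfolding C(4) convex_hull_finite[OF C(1)] by blast
  then show "\<exists>C. ?R C" ..
next
  assume "\<exists>C. ?R C"
  then obtain C where C: "?R C" ..
  then have fin: "finite C" by blast
  have "\<not> affine_dependent C"
    unfolding affine_dependent_explicit_finite[OF fin] using C by blast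
  moreover have "S = convex hull C"
    unfolding convex_hull_finite[OF fin] using C by blast
  moreover have "card C > 0"
    using C by (simp add: card_gt_0_iff)
  then have "int (card C) = int (card C - 1) + 1"
    by linarith
  ultimately show ?L
    unfolding simplex_def by blast
qed

definition simplex_face :: "'a::euclidean_space set \<Rightarrow> 'a set \<Rightarrow> bool" where
  "simplex_face F S \<longleftrightarrow>
     (\<exists>C D. \<not> affine_dependent C \<and> S = convex hull C \<and>
            D \<subseteq> C \<and> D \<noteq> {} \<and> F = convex hull D)"

text \<open>
  The library's \<^const>\<open>simplicial_complex\<close> is restricted to finite collections; here infinite
  collections are allowed and the empty collection is not.
\<close>

definition geometric_complex :: "'a::euclidean_space set set \<Rightarrow> bool" where
  "geometric_complex \<K> \<longleftrightarrow>
     \<K> \<noteq> {} \<and>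
     (\<forall>\<sigma>\<in>\<K>. \<exists>n::nat. int n simplex \<sigma>) \<and>
     (\<forall>\<sigma>\<in>\<K>. \<forall>F. simplex_face F \<sigma> \<longrightarrow> F \<in> \<K>) \<and>
     (\<forall>\<sigma>\<in>\<K>. \<forall>\<tau>\<in>\<K>. \<sigma> \<inter> \<tau> = {} \<or>
        simplex_face (\<sigma> \<inter> \<tau>) \<sigma> \<and> simplex_face (\<sigma> \<inter> \<tau>) \<tau>)"

definition complex_vertices :: "'a set set \<Rightarrow> 'a set" where
  "complex_vertices \<K> = {a. {a} \<in> \<K>}"

definition locally_finite_complex :: "'a set set \<Rightarrow> bool" where
  "locally_finite_complex \<K> \<longleftrightarrow> (\<forall>a\<in>complex_vertices \<K>. finite {\<sigma>\<in>\<K>. a \<in> \<sigma>})"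

text \<open>
  In general this is strictly finer than the subspace topology on \<open>\<Union>\<K>\<close>.
\<close>

definition underlying_space :: "'a::topological_space set set \<Rightarrow> 'a topology" where
  "underlying_space \<K> =
     topology (\<lambda>U. U \<subseteq> \<Union>\<K> \<and> (\<forall>\<sigma>\<in>\<K>. openin (top_of_set \<sigma>) (U \<inter> \<sigma>)))"

lemma openin_underlying_space:
  "openin (underlying_space \<K>) U \<longleftrightarrow>
     U \<subseteq> \<Union>\<K> \<and> (\<forall>\<sigma>\<in>\<K>. openin (top_of_set \<sigma>) (U \<inter> \<sigma>))"
proof -
  have "istopology (\<lambda>U. U \<subseteq> \<Union>\<K> \<and> (\<forall>\<sigma>\<in>\<K>. openin (top_of_set \<sigma>) (U \<inter> \<sigma>)))"
    unfolding istopology_def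
  proof (intro conjI allI impI ballI)
    fix S T \<sigma>
    assume S: "S \<subseteq> \<Union>\<K> \<and> (\<forall>\<sigma>\<in>\<K>. openin (top_of_set \<sigma>) (S \<inter> \<sigma>))"
      and T: "T \<subseteq> \<Union>\<K> \<and> (\<forall>\<sigma>\<in>\<K>. openin (top_of_set \<sigma>) (T \<inter> \<sigma>))"
    show "S \<inter> T \<subseteq> \<Union>\<K>"
      using S by blast
    assume "\<sigma> \<in> \<K>"
    then have "openin (top_of_set \<sigma>) ((S \<inter> \<sigma>) \<inter> (T \<inter> \<sigma>))"
      using S T by blast
    also have "(S \<inter> \<sigma>) \<inter> (T \<inter> \<sigma>) = S \<inter> T \<inter> \<sigma>"
      by blast
    finally show "openin (top_of_set \<sigma>) (S \<inter> T \<inter> \<sigma>)" .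
  next
    fix \<U> \<sigma>
    assume U: "\<forall>U\<in>\<U>. U \<subseteq> \<Union>\<K> \<and> (\<forall>\<sigma>\<in>\<K>. openin (top_of_set \<sigma>) (U \<inter> \<sigma>))"
    show "\<Union>\<U> \<subseteq> \<Union>\<K>"
      using U by blast
    assume "\<sigma> \<in> \<K>"
    then have "openin (top_of_set \<sigma>) (\<Union>U\<in>\<U>. U \<inter> \<sigma>)"
      using U by (intro openin_Union) auto
    also have "(\<Union>U\<in>\<U>. U \<inter> \<sigma>) = \<Union>\<U> \<inter> \<sigma>"
      by blast
    finally show "openin (top_of_set \<sigma>) (\<Union>\<U> \<inter> \<sigma>)" .
  qed
  then show ?thesis
    by (simp add: underlying_space_def)
qed

lemma topspace_underlying_space [simp]: "topspace (underlying_space \<K>) = \<Union>\<K>"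
proof
  show "topspace (underlying_space \<K>) \<subseteq> \<Union>\<K>"
    using openin_topspace[of "underlying_space \<K>"] unfolding openin_underlying_space by blast
  have "openin (underlying_space \<K>) (\<Union>\<K>)"
    unfolding openin_underlying_space by (auto simp: Int_absorb1 Union_upper)
  then show "\<Union>\<K> \<subseteq> topspace (underlying_space \<K>)"
    by (rule openin_subset)
qed

text \<open>
  The library's \<^const>\<open>locally_compact_space\<close> only asks for an open neighbourhood contained in
  some compact set, which is weaker in non-Hausdorff spaces. Here the closure itself is
  required to be compact.
\<close>

definition locally_compact_closure :: "'a topology \<Rightarrow> bool" where
  "locally_compact_closure X \<longleftrightarrow>
     (\<forall>x\<in>topspace X. \<exists>U. openin X U \<and> x \<in> U \<and> compactin X (X closure_of U))"

end

theory Submission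
  imports Defs
begin

text \<open>
  A union of arbitrarily many simplices of \<open>\<K>\<close> is closed, because it meets every simplex in a
  union of some of its finitely many faces. If \<open>\<K>\<close> is locally finite, every point \<open>x\<close> lies in only
  finitely many simplices, and their union is a compact neighbourhood of \<open>x\<close>: the points outside
  all simplices avoiding \<open>x\<close> form an open set inside it. Conversely, if a vertex \<open>a\<close> lay in
  infinitely many simplices, one could choose in the relative interior of each of them a point of
  a given neighbourhood of \<open>a\<close>; every subset of this infinite set of points meets each simplex in a
  finite set, so it is an infinite closed discrete set and the closure of the neighbourhood is not
  compact.
\<close>

lemma simplex_face_imp_face_of:
  assumes "simplex_face F S"
  shows "F face_of S"
  using assms face_of_convex_hull_affine_independent unfolding simplex_face_def by blast

lemma simplex_face_nonempty:
  assumes "simplex_face F S"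
  shows "F \<noteq> {}"
  using assms unfolding simplex_face_def by auto

lemma geometric_complex_simplex:
  assumes "geometric_complex \<K>" "\<sigma> \<in> \<K>"
  obtains C where "\<not> affine_dependent C" "C \<noteq> {}" "\<sigma> = convex hull C"
proof -
  obtain n :: nat where "int n simplex \<sigma>"
    using assms unfolding geometric_complex_def by blast
  then obtain C where C: "\<not> affine_dependent C" "int (card C) = int n + 1" "\<sigma> = convex hull C"
    unfolding simplex by blast
  then have "C \<noteq> {}" by auto
  with C show thesis using that by blast
qed

lemma geometric_complex_polytope:
  assumes "geometric_complex \<K>" "\<sigma> \<in> \<K>"
  shows "polytope \<sigma>"
  using geometric_complex_simplex[OF assms] aff_independent_finite polytope_convex_hull by metis

lemma geometric_complex_convex:
  assumes "geometric_complex \<K>" "\<sigma> \<in> \<K>"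
  shows "convex \<sigma>"
  using geometric_complex_polytope[OF assms] by (rule polytope_imp_convex)

lemma geometric_complex_Int_face:
  assumes "geometric_complex \<K>" "\<sigma> \<in> \<K>" "\<tau> \<in> \<K>" "\<sigma> \<inter> \<tau> \<noteq> {}"
  shows "simplex_face (\<sigma> \<inter> \<tau>) \<sigma>" "simplex_face (\<sigma> \<inter> \<tau>) \<tau>"
  using assms unfolding geometric_complex_def by blast+

text \<open>Each non-empty trace on the polytope \<open>\<tau>\<close> is a face of it, and a
  polytope has only finitely many faces.\<close>

lemma finite_Int_simplices:
  assumes "geometric_complex \<K>" "\<tau> \<in> \<K>"
  shows "finite ((\<lambda>\<sigma>. \<sigma> \<inter> \<tau>) ` \<K>)"
proof (rule finite_subset)
  show "(\<lambda>\<sigma>. \<sigma> \<inter> \<tau>) ` \<K> \<subseteq> insert {} {F. F face_of \<tau>}"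
    using geometric_complex_Int_face(2)[OF assms(1) _ assms(2)] simplex_face_imp_face_of by auto
  show "finite (insert {} {F. F face_of \<tau>})"
    using finite_polytope_faces[OF geometric_complex_polytope[OF assms]] by simp
qed

text \<open>\<open>\<sigma> \<inter> \<tau>\<close> is a face of \<open>\<sigma>\<close>, and a face
  containing a relative interior point of \<open>\<sigma>\<close> is all of
  \<open>\<sigma>\<close>.\<close>

lemma subset_of_rel_interior_meets:
  assumes "geometric_complex \<K>" "\<sigma> \<in> \<K>" "\<tau> \<in> \<K>" "x \<in> rel_interior \<sigma>" "x \<in> \<tau>"
  shows "\<sigma> \<subseteq> \<tau>"
proof -
  have "x \<in> \<sigma> \<inter> \<tau>"
    using assms(4,5) rel_interior_subset by blast
  then have "(\<sigma> \<inter> \<tau>) face_of \<sigma>"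
    using geometric_complex_Int_face(1)[OF assms(1-3)] simplex_face_imp_face_of by blast
  then have "\<sigma> \<subseteq> \<sigma> \<inter> \<tau>"
    using \<open>x \<in> \<sigma> \<inter> \<tau>\<close> assms(4) subset_of_face_of[of "\<sigma> \<inter> \<tau>" \<sigma> \<sigma>] by blast
  then show ?thesis by blast
qed

text \<open>A simplex inside \<open>\<tau>\<close> equals its own trace on \<open>\<tau>\<close>,
  and there are finitely many traces.\<close>

lemma finite_simplices_subset:
  assumes "geometric_complex \<K>" "\<tau> \<in> \<K>"
  shows "finite {\<sigma>\<in>\<K>. \<sigma> \<subseteq> \<tau>}"
  by (rule finite_subset[OF _ finite_Int_simplices[OF assms]]) (auto simp: image_iff)

lemma closedin_underlying_space:
  "closedin (underlying_space \<K>) A \<longleftrightarrow>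
     A \<subseteq> \<Union>\<K> \<and> (\<forall>\<sigma>\<in>\<K>. closedin (top_of_set \<sigma>) (A \<inter> \<sigma>))"
proof -
  have "openin (top_of_set \<sigma>) ((\<Union>\<K> - A) \<inter> \<sigma>) \<longleftrightarrow> closedin (top_of_set \<sigma>) (A \<inter> \<sigma>)"
    if "\<sigma> \<in> \<K>" for \<sigma>
  proof -
    have "(\<Union>\<K> - A) \<inter> \<sigma> = \<sigma> - A \<inter> \<sigma>" using that by blast
    then show ?thesis by (simp add: closedin_def)
  qed
  then show ?thesis
    by (auto simp: closedin_def[of "underlying_space \<K>"] openin_underlying_space)
qed

lemma closedin_Union_simplices:
  assumes "geometric_complex \<K>" "\<A> \<subseteq> \<K>"
  shows "closedin (underlying_space \<K>) (\<Union>\<A>)"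
  unfolding closedin_underlying_space
proof (intro conjI ballI)
  show "\<Union>\<A> \<subseteq> \<Union>\<K>" using assms(2) by blast
  fix \<sigma> assume \<sigma>: "\<sigma> \<in> \<K>"
  have "finite ((\<lambda>\<tau>. \<tau> \<inter> \<sigma>) ` \<A>)"
    using finite_Int_simplices[OF assms(1) \<sigma>] by (rule finite_subset[rotated]) (use assms(2) in blast)
  moreover have "closed (\<tau> \<inter> \<sigma>)" if "\<tau> \<in> \<A>" for \<tau>
    using that assms(2) \<sigma> geometric_complex_polytope[OF assms(1)]
    by (meson closed_Int polytope_imp_closed subsetD)
  ultimately have "closed (\<Union>((\<lambda>\<tau>. \<tau> \<inter> \<sigma>) ` \<A>))"
    by (intro closed_Union) auto
  moreover have "\<Union>((\<lambda>\<tau>. \<tau> \<inter> \<sigma>) ` \<A>) = \<Union>\<A> \<inter> \<sigma>" by blast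
  ultimately show "closedin (top_of_set \<sigma>) (\<Union>\<A> \<inter> \<sigma>)"
    by (intro closed_subset) auto
qed

text \<open>The topology here may be finer than the Euclidean one, so Euclidean compactness has to
  be transferred. Open sets of the underlying space have open traces on \<open>\<sigma>\<close>,
  which makes the inclusion of \<open>\<sigma>\<close> continuous.\<close>

lemma compactin_simplex:
  assumes "geometric_complex \<K>" "\<sigma> \<in> \<K>"
  shows "compactin (underlying_space \<K>) \<sigma>"
proof -
  have "continuous_map (top_of_set \<sigma>) (underlying_space \<K>) (\<lambda>x. x)"
  proof -
    have "{x \<in> \<sigma>. x \<in> U} = U \<inter> \<sigma>" for U by blast
    then show ?thesis
      using assms(2) by (auto simp: continuous_map openin_underlying_space)
  qed
  moreover have "compactin (top_of_set \<sigma>) \<sigma>"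
    using polytope_imp_compact[OF geometric_complex_polytope[OF assms]]
    by (simp add: compactin_subtopology)
  ultimately show ?thesis
    using image_compactin by fastforce
qed

text \<open>Fix one simplex \<open>\<sigma>\<close> through \<open>x\<close>. Every simplex through
  \<open>x\<close> contains one of the finitely many vertices of \<open>\<sigma>\<close>, and each
  vertex lies in finitely many simplices.\<close>

lemma locally_finite_imp_point_finite:
  assumes "geometric_complex \<K>" "locally_finite_complex \<K>"
  shows "finite {\<tau>\<in>\<K>. x \<in> \<tau>}"
proof (cases "x \<in> \<Union>\<K>")
  case True
  then obtain \<sigma> where \<sigma>: "\<sigma> \<in> \<K>" "x \<in> \<sigma>" by blast
  obtain C where C: "\<not> affine_dependent C" "\<sigma> = convex hull C"
    using geometric_complex_simplex[OF assms(1) \<sigma>(1)] by blast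
  have vertex: "{v} \<in> \<K>" if "v \<in> C" for v
  proof -
    have "simplex_face {v} \<sigma>"
      unfolding simplex_face_def using C that by (intro exI[of _ C] exI[of _ "{v}"]) auto
    then show ?thesis
      using assms(1) \<sigma>(1) unfolding geometric_complex_def by blast
  qed
  \<comment> \<open>The face \<open>\<sigma> \<inter> \<tau>\<close> of \<open>\<sigma>\<close> is
    spanned by a non-empty \<open>D \<subseteq> C\<close>, and any point of \<open>D\<close> serves
    as \<open>v\<close>.\<close>
  have "\<exists>v\<in>C. v \<in> \<tau>" if "\<tau> \<in> \<K>" "x \<in> \<tau>" for \<tau>
  proof -
    have "simplex_face (\<sigma> \<inter> \<tau>) \<sigma>"
      using geometric_complex_Int_face(1)[OF assms(1) \<sigma>(1) that(1)] \<sigma>(2) that(2) by blast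
    then have "(\<sigma> \<inter> \<tau>) face_of convex hull C" "\<sigma> \<inter> \<tau> \<noteq> {}"
      using simplex_face_imp_face_of simplex_face_nonempty C(2) by blast+
    then obtain D where "D \<subseteq> C" "\<sigma> \<inter> \<tau> = convex hull D" "D \<noteq> {}"
      using face_of_convex_hull_affine_independent[OF C(1)] by (metis convex_hull_empty)
    then show ?thesis
      using hull_subset[of D convex] by blast
  qed
  then have "{\<tau>\<in>\<K>. x \<in> \<tau>} \<subseteq> (\<Union>v\<in>C. {\<tau>\<in>\<K>. v \<in> \<tau>})" by blast
  moreover have "finite (\<Union>v\<in>C. {\<tau>\<in>\<K>. v \<in> \<tau>})"
    using assms(2) vertex aff_independent_finite[OF C(1)]
    by (simp add: locally_finite_complex_def complex_vertices_def)
  ultimately show ?thesis by (rule finite_subset)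
next
  case False
  then have "{\<tau>\<in>\<K>. x \<in> \<tau>} = {}" by blast
  then show ?thesis by (simp only: finite.emptyI)
qed

lemma locally_finite_imp_locally_compact:
  assumes "geometric_complex \<K>" "locally_finite_complex \<K>"
  shows "locally_compact_closure (underlying_space \<K>)"
  unfolding locally_compact_closure_def
proof
  let ?X = "underlying_space \<K>"
  fix x assume x: "x \<in> topspace ?X"
  \<comment> \<open>This is the open star of \<open>x\<close>: every simplex meeting
    \<open>U\<close> contains \<open>x\<close>.\<close>
  define U where "U = \<Union>\<K> - \<Union>{\<tau>\<in>\<K>. x \<notin> \<tau>}"
  have "openin ?X U"
    using closedin_Union_simplices[OF assms(1), of "{\<tau>\<in>\<K>. x \<notin> \<tau>}"]
    by (simp add: closedin_def U_def)
  moreover have "x \<in> U" using x by (auto simp: U_def)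
  moreover have "compactin ?X (\<Union>{\<tau>\<in>\<K>. x \<in> \<tau>})"
    using locally_finite_imp_point_finite[OF assms] compactin_simplex[OF assms(1)]
    by (intro compactin_Union) auto
  moreover have "?X closure_of U \<subseteq> \<Union>{\<tau>\<in>\<K>. x \<in> \<tau>}"
    by (intro closure_of_minimal closedin_Union_simplices assms) (auto simp: U_def)
  ultimately show "\<exists>U. openin ?X U \<and> x \<in> U \<and> compactin ?X (?X closure_of U)"
    using closed_compactin[OF _ _ closedin_closure_of] by blast
qed

text \<open>An infinite \<open>S\<close> would have an accumulation point \<open>x\<close> in the
  compact set. Finite sets are closed in each simplex, so \<open>S - {x}\<close> is closed, and its
  complement is a neighbourhood of \<open>x\<close> that meets \<open>S\<close> at most in
  \<open>x\<close>.\<close>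

lemma compactin_subset_finite_if_meets_finite:
  fixes \<K> :: "'a::t1_space set set"
  assumes "compactin (underlying_space \<K>) K" "S \<subseteq> K"
    and fin: "\<And>\<tau>. \<tau> \<in> \<K> \<Longrightarrow> finite (S \<inter> \<tau>)"
  shows "finite S"
proof (rule ccontr)
  let ?X = "underlying_space \<K>"
  assume "infinite S"
  then obtain x where x: "x \<in> ?X derived_set_of S"
    using compactin_imp_Bolzano_Weierstrass[OF assms(1), of S] assms(2) by blast
  have "S \<subseteq> \<Union>\<K>"
    using assms(2) compactin_subset_topspace[OF assms(1)] by simp
  then have "closedin ?X (S - {x})"
    unfolding closedin_underlying_space
  proof (intro conjI ballI)
    fix \<tau> assume "\<tau> \<in> \<K>"
    then have "finite ((S - {x}) \<inter> \<tau>)"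
      by (auto intro: finite_subset[OF _ fin])
    then show "closedin (top_of_set \<tau>) ((S - {x}) \<inter> \<tau>)"
      by (intro closed_subset finite_imp_closed) auto
  qed auto
  then have "openin ?X (\<Union>\<K> - (S - {x}))"
    by (simp add: closedin_def)
  moreover have "x \<in> \<Union>\<K> - (S - {x})"
    using x derived_set_of_subset_topspace[of ?X S] by auto
  ultimately obtain y where "y \<noteq> x" "y \<in> S" "y \<in> \<Union>\<K> - (S - {x})"
    using x unfolding in_derived_set_of by metis
  then show False by blast
qed

lemma locally_compact_imp_locally_finite:
  assumes "geometric_complex \<K>" "locally_compact_closure (underlying_space \<K>)"
  shows "locally_finite_complex \<K>"
  unfolding locally_finite_complex_def complex_vertices_def
proof clarify
  let ?X = "underlying_space \<K>"
  fix a assume "{a} \<in> \<K>"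
  then obtain U where U: "openin ?X U" "a \<in> U" "compactin ?X (?X closure_of U)"
    using assms(2) unfolding locally_compact_closure_def by force
  define A where "A = {\<sigma>\<in>\<K>. a \<in> \<sigma>}"
  \<comment> \<open>By convexity \<open>a\<close> lies in the closure of the relative interior of
    \<open>\<sigma>\<close>, so neighbourhoods of \<open>a\<close> reach that interior.\<close>
  have "\<exists>x. x \<in> U \<inter> rel_interior \<sigma>" if "\<sigma> \<in> A" for \<sigma>
  proof -
    have \<sigma>: "\<sigma> \<in> \<K>" "a \<in> \<sigma>" using that by (auto simp: A_def)
    then obtain V where V: "open V" "U \<inter> \<sigma> = \<sigma> \<inter> V"
      using U(1) unfolding openin_underlying_space openin_open by blast
    have "a \<in> closure (rel_interior \<sigma>)"
      using \<sigma> closure_subset convex_closure_rel_interior[OF geometric_complex_convex[OF assms(1)]]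
      by blast
    moreover have "a \<in> V" using V \<sigma> U by blast
    ultimately have "V \<inter> rel_interior \<sigma> \<noteq> {}"
      using V(1) open_Int_closure_eq_empty by blast
    then show ?thesis using V(2) rel_interior_subset by blast
  qed
  then obtain p where p: "\<And>\<sigma>. \<sigma> \<in> A \<Longrightarrow> p \<sigma> \<in> U" "\<And>\<sigma>. \<sigma> \<in> A \<Longrightarrow> p \<sigma> \<in> rel_interior \<sigma>"
    unfolding Int_iff by metis
  \<comment> \<open>Used twice: applied in both directions it makes \<open>p\<close> injective, and
    it restricts the points \<open>p \<sigma>\<close> in a given \<open>\<tau>\<close> to those with
    \<open>\<sigma> \<subseteq> \<tau>\<close>, of which there are finitely many.\<close>
  have sub: "\<sigma> \<subseteq> \<tau>" if "\<sigma> \<in> A" "\<tau> \<in> \<K>" "p \<sigma> \<in> \<tau>" for \<sigma> \<tau>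
    using subset_of_rel_interior_meets[OF assms(1) _ that(2) p(2)[OF that(1)] that(3)] that(1)
    by (simp add: A_def)
  have "inj_on p A"
  proof (rule inj_onI)
    fix \<sigma> \<tau> assume *: "\<sigma> \<in> A" "\<tau> \<in> A" "p \<sigma> = p \<tau>"
    have "p \<rho> \<in> \<rho>" if "\<rho> \<in> A" for \<rho>
      using p(2)[OF that] rel_interior_subset by blast
    then have "p \<sigma> \<in> \<tau>" "p \<tau> \<in> \<sigma>"
      using * by metis+
    moreover have "\<sigma> \<in> \<K>" "\<tau> \<in> \<K>" using * by (auto simp: A_def)
    ultimately show "\<sigma> = \<tau>"
      using sub[of \<sigma> \<tau>] sub[of \<tau> \<sigma>] * by (simp add: subset_antisym)
  qed
  moreover have "finite (p ` A)"
  proof (rule compactin_subset_finite_if_meets_finite[OF U(3)])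
    show "p ` A \<subseteq> ?X closure_of U"
      using p(1) closure_of_subset[OF openin_subset[OF U(1)]] by blast
    fix \<tau> assume \<tau>: "\<tau> \<in> \<K>"
    have "p ` A \<inter> \<tau> \<subseteq> p ` {\<sigma>\<in>\<K>. \<sigma> \<subseteq> \<tau>}"
      using sub[OF _ \<tau>] by (auto simp: A_def)
    then show "finite (p ` A \<inter> \<tau>)"
      using finite_simplices_subset[OF assms(1) \<tau>] finite_subset by blast
  qed
  ultimately show "finite {\<sigma>\<in>\<K>. a \<in> \<sigma>}"
    unfolding A_def[symmetric] using finite_imageD by blast
qed

theorem lemma4p28:
  fixes \<K> :: "(real ^ 'n) set set"
  assumes "geometric_complex \<K>"
  shows "locally_finite_complex \<K> \<longleftrightarrow> locally_compact_closure (underlying_space \<K>)"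
  using locally_finite_imp_locally_compact[OF assms] locally_compact_imp_locally_finite[OF assms]
  by blast

end
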